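(* Let $f\in\mathbb{C}[X,Y]$ be a quasi-convenient polynomial such that (1) $f$ is nondegenerate at infinity, and (2) for every nonzero real vector $\vec w=[p,q]$ with $pq\le 0$, the system of equations $\operatorname{in}(f,\vec w)(X,Y)=\operatorname{in}(f,-\vec w)(X,Y)=0$ has no solutions in $\mathbb{C}^*\times\mathbb{C}^*$. Then $f$ is nearly irreducible.
   Context: Write $f=\sum c_{\alpha\beta}X^\alpha Y^\beta\in\mathbb{C}[X,Y]$ and $\operatorname{supp} f=\{(\alpha,\beta)\in\mathbb{N}^2: c_{\alpha\beta}\neq 0\}$. A nonzero polynomial $f$ of positive degree is quasi-convenient if $c_{\alpha 0}\neq 0$ and $c_{0\beta}\neq 0$ for some integers $\alpha,\beta\ge 0$. For a nonzero real vector $\vec w=[p,q]$, let $d_{\vec w}(f)=\max\{p\alpha+q\beta:(\alpha,\beta)\in\operatorname{supp} f\}$ and $\operatorname{in}(f,\vec w)=\sum_{p\alpha+q\beta=d_{\vec w}(f)} c_{\alpha\beta}X^\alpha Y^\beta$. A quasi-convenient $f$ is nondegenerate at infinity if for every real vector $\vec w=[p,q]$ with $p>0$ or $q>0$ the system $\operatorname{in}(f,\vec w)=\frac{\partial}{\partial X}\operatorname{in}(f,\vec w)=\frac{\partial}{\partial Y}\operatorname{in}(f,\vec w)=0$ has no solutions in $\mathbb{C}^*\times\mathbb{C}^*$, where $\mathbb{C}^*=\mathbb{C}\setminus\{0\}$. A polynomial $f$ of positive degree is nearly irreducible if any two nonconstant polynomial factors $g,h\in\mathbb{C}[X,Y]$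 of $f$ have a common zero in $\mathbb{C}^2$. *)

theory Defs
  imports "HOL-Computational_Algebra.Polynomial"
begin

text \<open>Bivariate polynomials in C[X,Y] are represented as complex poly poly,
  i.e. polynomials in Y with coefficients in C[X].  The coefficient of
  X^a Y^b in f is coeff (coeff f b) a.\<close>

type_synonym bipoly = "complex poly poly"

definition cf2 :: "bipoly \<Rightarrow> nat \<Rightarrow> nat \<Rightarrow> complex" where
  "cf2 f a b = coeff (coeff f b) a"

definition supp2 :: "bipoly \<Rightarrow> (nat \<times> nat) set" where
  "supp2 f = {(a, b). cf2 f a b \<noteq> 0}"

definition eval2 :: "bipoly \<Rightarrow> complex \<Rightarrow> complex \<Rightarrow> complex" where
  "eval2 f x y = poly (map_poly (\<lambda>p. poly p x) f) y"

definition pderivX :: "bipoly \<Rightarrow> bipoly" where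
  "pderivX f = map_poly pderiv f"

definition pderivY :: "bipoly \<Rightarrow> bipoly" where
  "pderivY f = pderiv f"

definition pos_degree :: "bipoly \<Rightarrow> bool" where
  "pos_degree f \<longleftrightarrow> (\<exists>(a, b) \<in> supp2 f. a + b > 0)"

definition quasi_convenient :: "bipoly \<Rightarrow> bool" where
  "quasi_convenient f \<longleftrightarrow> f \<noteq> 0 \<and> pos_degree f \<and>
     (\<exists>a. cf2 f a 0 \<noteq> 0) \<and> (\<exists>b. cf2 f 0 b \<noteq> 0)"

definition wval :: "real \<times> real \<Rightarrow> nat \<times> nat \<Rightarrow> real" where
  "wval w ab = fst w * real (fst ab) + snd w * real (snd ab)"

definition wdeg :: "real \<times> real \<Rightarrow> bipoly \<Rightarrow> real" where
  "wdeg w f = Max (wval w ` supp2 f)"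

definition initial :: "bipoly \<Rightarrow> real \<times> real \<Rightarrow> bipoly" where
  "initial f w = (\<Sum>ab \<in> {ab \<in> supp2 f. wval w ab = wdeg w f}.
       monom (monom (cf2 f (fst ab) (snd ab)) (fst ab)) (snd ab))"

definition nondeg_at_infinity :: "bipoly \<Rightarrow> bool" where
  "nondeg_at_infinity f \<longleftrightarrow> quasi_convenient f \<and>
     (\<forall>p q :: real. (p > 0 \<or> q > 0) \<longrightarrow>
        \<not> (\<exists>x y. x \<noteq> 0 \<and> y \<noteq> 0 \<and>
              eval2 (initial f (p, q)) x y = 0 \<and>
              eval2 (pderivX (initial f (p, q))) x y = 0 \<and>
              eval2 (pderivY (initial f (p, q))) x y = 0))"

definition nearly_irreducible :: "bipoly \<Rightarrow> bool" where
  "nearly_irreducible f \<longleftrightarrow> pos_degree f \<and>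
     (\<forall>g h. g dvd f \<longrightarrow> h dvd f \<longrightarrow> pos_degree g \<longrightarrow> pos_degree h \<longrightarrow>
        (\<exists>x y. eval2 g x y = 0 \<and> eval2 h x y = 0))"

end

theory Submission
  imports Defs "HOL-Complex_Analysis.Complex_Analysis"
    "HOL-Computational_Algebra.Computational_Algebra"
    "HOL-Computational_Algebra.Field_as_Ring" "Subresultants.Subresultant_Gcd"
begin

text \<open>
  Suppose that two nonconstant factors \<open>g\<close>, \<open>h\<close> of \<open>f\<close> have no common zero. They are coprime, so
  \<open>g h\<close> divides \<open>f\<close>, and nondegeneracy makes the initial forms of \<open>g\<close> and \<open>h\<close> disjoint in the
  torus for every weight \<open>[p, q]\<close> with \<open>p > 0\<close> or \<open>q > 0\<close>. Along a branch at infinity of the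
  curve \<open>g = 0\<close> the polynomial \<open>h\<close> therefore grows like its weighted degree, which is nonnegative
  since \<open>h\<close> is quasi-convenient. Hence \<open>\<bar>h\<bar>\<close> is bounded away from zero on the curve, and by
  elimination \<open>h\<close> takes only finitely many values there. So the weighted degree of \<open>h\<close> is
  nonpositive for every outer edge normal of the Newton polygon of \<open>g\<close> with \<open>p > 0\<close> or \<open>q > 0\<close>.
  As \<open>h\<close> contains a monomial with exponent \<open>v \<noteq> 0\<close>, this forces the polygon of \<open>g\<close> to be a
  segment parallel to \<open>v\<close>. Then \<open>g\<close> is its own initial form for both normals of that segment,
  contradicting the second hypothesis.
\<close>

subsection \<open>Bivariate polynomials and their evaluation\<close>

text \<open>Substituting the constant \<open>[:y:]\<close> first makes evaluation a composition of
  two \<open>poly\<close> homomorphisms, so ring laws come from the simplifier.\<close>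

lemma eval2_altdef: "eval2 f x y = poly (poly f [:y:]) x"
  by (induction f) (simp_all add: eval2_def map_poly_pCons)

lemma eval2_mult: "eval2 (f * g) x y = eval2 f x y * eval2 g x y"
  and eval2_add: "eval2 (f + g) x y = eval2 f x y + eval2 g x y"
  by (simp_all add: eval2_altdef)

lemma cf2_eqI: "(\<And>a b. cf2 f a b = cf2 g a b) \<Longrightarrow> f = g"
  by (simp add: cf2_def poly_eq_iff)

lemma supp2_eq_empty_iff: "supp2 f = {} \<longleftrightarrow> f = 0"
proof
  assume "supp2 f = {}"
  then show "f = 0" by (intro cf2_eqI) (auto simp: supp2_def cf2_def)
qed (simp add: supp2_def cf2_def)

lemma supp2_subset:
  "supp2 f \<subseteq> (\<lambda>(b, a). (a, b)) ` (SIGMA b:{..degree f}. {..degree (coeff f b)})"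
  by (force simp: supp2_def cf2_def intro: le_degree)

lemma finite_supp2: "finite (supp2 f)"
  by (rule finite_subset[OF supp2_subset]) auto

lemma eval2_eq_sum:
  "eval2 f x y = (\<Sum>ab\<in>supp2 f. cf2 f (fst ab) (snd ab) * x ^ fst ab * y ^ snd ab)"
proof -
  let ?S = "SIGMA b:{..degree f}. {..degree (coeff f b)}"
  let ?t = "\<lambda>ab. cf2 f (fst ab) (snd ab) * x ^ fst ab * y ^ snd ab"
  have "eval2 f x y = (\<Sum>b\<le>degree f. \<Sum>a\<le>degree (coeff f b). ?t (a, b))"
    by (simp add: eval2_altdef poly_altdef[of f] poly_sum poly_power poly_altdef[of "coeff f _"]
        cf2_def sum_distrib_right)
  also have "\<dots> = (\<Sum>(b, a)\<in>?S. ?t (a, b))"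
    by (subst sum.Sigma) auto
  also have "\<dots> = (\<Sum>ab\<in>(\<lambda>(b, a). (a, b)) ` ?S. ?t ab)"
    by (subst sum.reindex) (auto simp: inj_on_def case_prod_unfold)
  also have "\<dots> = (\<Sum>ab\<in>supp2 f. ?t ab)"
    by (rule sum.mono_neutral_right[OF _ supp2_subset]) (auto simp: supp2_def)
  finally show ?thesis .
qed

text \<open>A nonzero polynomial over the domain C[X] has finitely many roots there, but every
  constant \<open>[:y:]\<close> would be one.\<close>

lemma eval2_all_0_imp_0:
  assumes "\<And>x y. eval2 f x y = 0"
  shows "f = 0"
proof (rule ccontr)
  assume "f \<noteq> 0"
  then have "finite {z. poly f z = 0}" by (rule poly_roots_finite)
  moreover have "range (\<lambda>y. [:y:]) \<subseteq> {z. poly f z = 0}"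
    using assms by (auto simp: eval2_altdef poly_all_0_iff_0[symmetric])
  ultimately have "finite (range (\<lambda>y::complex. [:y:]))" by (rule rev_finite_subset)
  then show False
    by (subst (asm) finite_image_iff) (auto simp: inj_on_def infinite_UNIV_char_0)
qed

lemma eval2_eqI:
  assumes "\<And>x y. eval2 f x y = eval2 g x y"
  shows "f = g"
  using eval2_all_0_imp_0[of "f - g"] assms by (simp add: eval2_altdef)

lemma nonzero_eval2E:
  assumes "f \<noteq> 0"
  obtains x y where "eval2 f x y \<noteq> 0"
  using assms eval2_all_0_imp_0 by blast

text \<open>Together with \<open>pderivY_mult\<close>, this turns a common zero of two factors into
  a singular zero of their product, which nondegeneracy forbids.\<close>

lemma pderivX_mult: "pderivX (f * g) = f * pderivX g + pderivX f * g"
proof (rule poly_eqI)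
  fix n
  show "coeff (pderivX (f * g)) n = coeff (f * pderivX g + pderivX f * g) n"
    by (simp add: pderivX_def coeff_map_poly coeff_mult pderiv_sum pderiv_mult sum.distrib)
      (simp add: mult.commute)
qed

lemma pderivY_mult: "pderivY (f * g) = f * pderivY g + pderivY f * g"
  by (simp add: pderivY_def pderiv_mult mult.commute)

subsection \<open>Initial forms\<close>

lemma cf2_sum: "cf2 (sum F A) a b = (\<Sum>i\<in>A. cf2 (F i) a b)"
  by (simp add: cf2_def coeff_sum)

lemma cf2_initial:
  "cf2 (initial f w) a b = (if (a, b) \<in> supp2 f \<and> wval w (a, b) = wdeg w f then cf2 f a b else 0)"
proof -
  have "cf2 (initial f w) a b =
      (\<Sum>ab \<in> {ab \<in> supp2 f. wval w ab = wdeg w f}. if ab = (a, b) then cf2 f a b else 0)"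
    unfolding initial_def cf2_sum
    by (rule sum.cong) (auto simp: cf2_def)
  then show ?thesis
    by (simp add: finite_supp2)
qed

lemma supp2_initial: "supp2 (initial f w) = {ab \<in> supp2 f. wval w ab = wdeg w f}"
  by (auto simp: supp2_def cf2_initial)

lemma eval2_initial:
  "eval2 (initial f w) x y =
    (\<Sum>ab\<in>supp2 f. if wval w ab = wdeg w f then cf2 f (fst ab) (snd ab) * x ^ fst ab * y ^ snd ab else 0)"
  unfolding eval2_eq_sum[of "initial f w"] supp2_initial
  by (subst sum.inter_filter[OF finite_supp2]) (auto simp: cf2_initial intro!: sum.cong)

lemma wval_le_wdeg: "ab \<in> supp2 f \<Longrightarrow> wval w ab \<le> wdeg w f"
  unfolding wdeg_def by (intro Max_ge) (auto simp: finite_supp2)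

lemma wdeg_attained:
  assumes "f \<noteq> 0"
  obtains ab where "ab \<in> supp2 f" "wval w ab = wdeg w f"
proof -
  have "Max (wval w ` supp2 f) \<in> wval w ` supp2 f"
    using assms by (intro Max_in) (auto simp: finite_supp2 supp2_eq_empty_iff)
  then show ?thesis using that unfolding wdeg_def by auto
qed

lemma initial_nonzero: "f \<noteq> 0 \<Longrightarrow> initial f w \<noteq> 0"
  using wdeg_attained[of f w] supp2_initial[of f w] supp2_eq_empty_iff[of "initial f w"] by auto

lemma initial_eq_self:
  assumes "\<And>ab. ab \<in> supp2 f \<Longrightarrow> wval w ab = c"
  shows "initial f w = f"
proof (cases "f = 0")
  case False
  then have "wdeg w f = c" using assms by (metis wdeg_attained)
  then show ?thesis using assms by (intro cf2_eqI) (auto simp: cf2_initial supp2_def)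
next
  case True
  then show ?thesis by (simp add: initial_def supp2_def cf2_def)
qed

section \<open>Initial forms as limits of a one-parameter scaling\<close>

lemma scaled_eval2_eq_sum:
  fixes s p q d :: real
  shows "of_real (exp (- s * d)) * eval2 f (x * of_real (exp (s * p))) (y * of_real (exp (s * q))) =
    (\<Sum>ab\<in>supp2 f. of_real (exp (s * (wval (p, q) ab - d))) *
        (cf2 f (fst ab) (snd ab) * x ^ fst ab * y ^ snd ab))"
proof -
  have "complex_of_real (exp (- s * d)) * (c * (x * of_real (exp (s * p))) ^ a * (y * of_real (exp (s * q))) ^ b)
      = of_real (exp (s * (wval (p, q) (a, b) - d))) * (c * x ^ a * y ^ b)" for c a b
  proof -
    have "exp (s * (wval (p, q) (a, b) - d)) = exp (- s * d) * exp (s * p) ^ a * exp (s * q) ^ b"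
      by (simp add: wval_def exp_add[symmetric] exp_of_nat_mult[symmetric] algebra_simps)
    then show ?thesis by (simp add: power_mult_distrib algebra_simps)
  qed
  note monomial = this
  show ?thesis
    unfolding eval2_eq_sum sum_distrib_left by (rule sum.cong) (simp_all only: monomial prod.collapse)
qed

lemma tendsto_exp_face:
  assumes "d \<le> (0::real)" "filterlim s at_top F"
  shows "((\<lambda>n. complex_of_real (exp (s n * d))) \<longlongrightarrow> (if d = 0 then 1 else 0)) F"
proof (cases "d = 0")
  case False
  then have "filterlim (\<lambda>n. s n * d) at_bot F"
    using assms filterlim_tendsto_neg_mult_at_bot[of "\<lambda>_. d" d F s] by (simp add: mult.commute)
  then have "((\<lambda>n. exp (s n * d)) \<longlongrightarrow> 0) F"
    by (rule filterlim_compose[OF exp_at_bot])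
  from tendsto_of_real[OF this] False show ?thesis by simp
qed simp

text \<open>After normalisation the exponents are nonpositive and vanish exactly on the face of
  maximal weight, so only the initial form survives. The base points may move with n, as they do
  along a branch at infinity.\<close>

lemma tendsto_scaled_eval2:
  assumes X: "(X \<longlongrightarrow> \<xi>) F" and Y: "(Y \<longlongrightarrow> \<eta>) F" and s: "filterlim s at_top F"
  shows "((\<lambda>n. of_real (exp (- s n * wdeg (p, q) f)) *
      eval2 f (X n * of_real (exp (s n * p))) (Y n * of_real (exp (s n * q))))
    \<longlongrightarrow> eval2 (initial f (p, q)) \<xi> \<eta>) F"
proof -
  have eq: "eval2 (initial f (p, q)) \<xi> \<eta> = (\<Sum>ab\<in>supp2 f.
      (if wval (p, q) ab - wdeg (p, q) f = 0 then 1 else 0) *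
      (cf2 f (fst ab) (snd ab) * \<xi> ^ fst ab * \<eta> ^ snd ab))"
    unfolding eval2_initial by (rule sum.cong) auto
  show ?thesis
    unfolding scaled_eval2_eq_sum eq
    by (intro tendsto_intros tendsto_exp_face X Y s) (use wval_le_wdeg in fastforce)
qed

text \<open>Growth rates are compared along a scaling orbit through a point where none of the three
  initial forms vanishes: there \<open>exp (s * ?c)\<close> has a finite nonzero limit, which forces
  \<open>?c = 0\<close>.\<close>

lemma wdeg_mult:
  assumes "f \<noteq> 0" "g \<noteq> 0"
  shows "wdeg w (f * g) = wdeg w f + wdeg w g"
proof -
  obtain p q where w: "w = (p, q)" by force
  let ?i = "\<lambda>f. initial f w" and ?d = "wdeg w"
  obtain x y where xy: "eval2 (?i f * ?i g * ?i (f * g)) x y \<noteq> 0"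
    by (rule nonzero_eval2E[of "?i f * ?i g * ?i (f * g)"]) (simp add: assms initial_nonzero)
  define E where "E = (\<lambda>f s. eval2 f (x * of_real (exp (s * p))) (y * of_real (exp (s * q))))"
  have lim: "((\<lambda>s. of_real (exp (- s * ?d f)) * E f s) \<longlongrightarrow> eval2 (?i f) x y) at_top" for f
    unfolding E_def w by (rule tendsto_scaled_eval2) (auto intro: filterlim_ident)
  let ?c = "?d (f * g) - (?d f + ?d g)"
  have "((\<lambda>s. (of_real (exp (- s * ?d f)) * E f s) * (of_real (exp (- s * ?d g)) * E g s) /
      (of_real (exp (- s * ?d (f * g))) * E (f * g) s)) \<longlongrightarrow>
      eval2 (?i f) x y * eval2 (?i g) x y / eval2 (?i (f * g)) x y) at_top"
    using xy by (intro tendsto_intros lim) (auto simp: eval2_mult)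
  moreover have "\<forall>\<^sub>F s in at_top. of_real (exp (- s * ?d (f * g))) * E (f * g) s \<noteq> 0"
    using lim[of "f * g"] by (rule tendsto_imp_eventually_ne) (use xy in \<open>auto simp: eval2_mult\<close>)
  then have "\<forall>\<^sub>F s in at_top. (of_real (exp (- s * ?d f)) * E f s) * (of_real (exp (- s * ?d g)) * E g s) /
      (of_real (exp (- s * ?d (f * g))) * E (f * g) s) = of_real (exp (s * ?c))"
  proof eventually_elim
    case (elim s)
    have "exp (s * ?c) = exp (- s * ?d f) * exp (- s * ?d g) / exp (- s * ?d (f * g))"
      by (simp add: exp_add[symmetric] exp_diff[symmetric] algebra_simps)
    then have "complex_of_real (exp (s * ?c)) =
        of_real (exp (- s * ?d f)) * of_real (exp (- s * ?d g)) / of_real (exp (- s * ?d (f * g)))"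
      by (metis of_real_mult of_real_divide)
    moreover have "E (f * g) s = E f s * E g s" by (simp add: E_def eval2_mult)
    ultimately show ?case using elim by simp
  qed
  ultimately have L: "((\<lambda>s. complex_of_real (exp (s * ?c))) \<longlongrightarrow>
      eval2 (?i f) x y * eval2 (?i g) x y / eval2 (?i (f * g)) x y) at_top"
    by (rule Lim_transform_eventually)
  let ?l = "eval2 (?i f) x y * eval2 (?i g) x y / eval2 (?i (f * g)) x y"
  have l0: "?l \<noteq> 0" using xy by (auto simp: eval2_mult)
  consider "?c < 0" | "?c > 0" | "?c = 0" by linarith
  then show ?thesis
  proof cases
    case 1
    then have "((\<lambda>s. complex_of_real (exp (s * ?c))) \<longlongrightarrow> 0) at_top"
      using tendsto_exp_face[of ?c "\<lambda>s. s" at_top] by (simp add: filterlim_ident)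
    then show ?thesis using L l0 by (metis tendsto_unique trivial_limit_at_top_linorder)
  next
    \<comment> \<open>The reciprocal exponential tends to 0, yet its product with the convergent one
      is constantly 1.\<close>
    case 2
    have "((\<lambda>s. complex_of_real (exp (s * (- ?c)))) \<longlongrightarrow> 0) at_top"
      using 2 tendsto_exp_face[of "- ?c" "\<lambda>s. s" at_top] by (simp add: filterlim_ident)
    from tendsto_mult[OF this L] have "((\<lambda>s::real. 1::complex) \<longlongrightarrow> 0) at_top"
      by (simp add: of_real_mult[symmetric] exp_add[symmetric] algebra_simps del: of_real_mult of_real_exp)
    then show ?thesis by (simp add: tendsto_const_iff)
  qed simp
qed

text \<open>Since weighted degrees add, the normalised evaluations multiply exactly, and so do their
  limits.\<close>

lemma initial_mult:
  assumes "f \<noteq> 0" "g \<noteq> 0"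
  shows "initial (f * g) w = initial f w * initial g w"
proof (rule eval2_eqI)
  fix x y
  obtain p q where w: "w = (p, q)" by force
  define E where "E = (\<lambda>f s. of_real (exp (- s * wdeg w f)) *
    eval2 f (x * of_real (exp (s * p))) (y * of_real (exp (s * q))))"
  have lim: "(E f \<longlongrightarrow> eval2 (initial f w) x y) at_top" for f
    unfolding E_def w by (rule tendsto_scaled_eval2) (auto intro: filterlim_ident)
  have "E (f * g) = (\<lambda>s. E f s * E g s)"
    by (auto simp: E_def wdeg_mult[OF assms] eval2_mult ring_distribs exp_add
        simp flip: uminus_add_conv_diff add_uminus_conv_diff)
  with tendsto_mult[OF lim[of f] lim[of g]] lim[of "f * g"]
  show "eval2 (initial (f * g) w) x y = eval2 (initial f w * initial g w) x y"
    by (simp add: eval2_mult) (metis tendsto_unique trivial_limit_at_top_linorder)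
qed

subsection \<open>Zeros in the torus\<close>

text \<open>Once the power of the variable is split off, a polynomial without nonzero roots has no
  roots at all, so it was a monomial.\<close>

lemma poly_nonzero_root:
  fixes p :: "complex poly"
  assumes "coeff p i \<noteq> 0" "coeff p j \<noteq> 0" "i \<noteq> j"
  shows "\<exists>z. z \<noteq> 0 \<and> poly p z = 0"
proof (rule ccontr)
  assume no: "\<not> ?thesis"
  have "p \<noteq> 0" using assms by auto
  then obtain r where r: "p = [:- 0, 1:] ^ order 0 p * r" "\<not> [:- 0, 1:] dvd r"
    using order_decomp by blast
  have "poly r z \<noteq> 0" for z
  proof (cases "z = 0")
    case False
    then show ?thesis using no r(1) by (metis mult_zero_right poly_mult)
  qed (use r(2) poly_eq_0_iff_dvd in blast)
  then have "degree r = 0"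
    using Fundamental_Theorem_Algebra.fundamental_theorem_of_algebra[of r] by (auto simp: constant_degree)
  then obtain c where "r = [:c:]" by (rule degree_eq_zeroE)
  with r(1) have "p = monom c (order 0 p)"
    by (simp add: monom_altdef)
  then have "i = order 0 p" "j = order 0 p"
    using assms by (metis coeff_monom)+
  then show False using assms by simp
qed

lemma eval2_monom: "eval2 (monom p b) x y = poly p x * y ^ b"
  by (simp add: eval2_altdef poly_monom)

text \<open>If two powers of Y occur, fixing a generic x leaves a polynomial in y with two terms.
  Otherwise f is a polynomial in X times a power of Y, and y = 1 works.\<close>

lemma torus_zero_exists:
  assumes ab: "ab \<in> supp2 f" and cd: "cd \<in> supp2 f" and "ab \<noteq> cd"
  obtains x y where "x \<noteq> 0" "y \<noteq> 0" "eval2 f x y = 0"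
proof (cases "\<exists>u\<in>supp2 f. \<exists>v\<in>supp2 f. snd u \<noteq> snd v")
  case True
  then obtain b b' where b: "coeff f b \<noteq> 0" "coeff f b' \<noteq> 0" "b \<noteq> b'"
    by (force simp: supp2_def cf2_def)
  \<comment> \<open>The factor \<open>[:0, 1:]\<close> keeps x nonzero; the other two keep both
    coefficients of powers of Y alive.\<close>
  then have "finite {x. poly ([:0, 1:] * coeff f b * coeff f b') x = 0}"
    by (intro poly_roots_finite) auto
  then obtain x where x: "poly ([:0, 1:] * coeff f b * coeff f b') x \<noteq> 0"
    by (metis (mono_tags, lifting) UNIV_eq_I infinite_UNIV_char_0 mem_Collect_eq)
  then obtain y where "y \<noteq> 0" "poly (map_poly (\<lambda>p. poly p x) f) y = 0"
    using poly_nonzero_root[of "map_poly (\<lambda>p. poly p x) f" b b'] b(3)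
    by (auto simp: coeff_map_poly)
  with x that[of x y] show ?thesis by (auto simp: eval2_def)
next
  case False
  define b where "b = snd ab"
  have "f = monom (coeff f b) b"
  proof (rule cf2_eqI)
    show "cf2 f i j = cf2 (monom (coeff f b) b) i j" for i j
      using False ab by (force simp: b_def supp2_def cf2_def)
  qed
  note f_eq = this
  have ev: "eval2 f x 1 = poly (coeff f b) x" for x
    using arg_cong[where f = "\<lambda>f. eval2 f x 1", OF f_eq] by (simp only: eval2_monom) simp
  have "snd cd = b" using False ab cd unfolding b_def by blast
  then have "fst ab \<noteq> fst cd" using assms by (metis b_def prod_eqI)
  moreover have "coeff (coeff f b) (fst ab) \<noteq> 0" "coeff (coeff f b) (fst cd) \<noteq> 0"
    using ab cd \<open>snd cd = b\<close> by (simp_all add: supp2_def cf2_def b_def case_prod_unfold)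
  ultimately obtain x where "x \<noteq> 0" "poly (coeff f b) x = 0"
    using poly_nonzero_root by blast
  with that[of x 1] ev show ?thesis by simp
qed

subsection \<open>Elimination\<close>

text \<open>After a generic shear both curves are finite over the x-axis.\<close>

definition shear :: "complex \<Rightarrow> bipoly \<Rightarrow> bipoly" where
  "shear t f = (\<Sum>(a, b)\<in>supp2 f. Polynomial.smult [:cf2 f a b:] ([:[:0, 1:], [:t:]:] ^ a * monom 1 b))"

lemma eval2_shear: "eval2 (shear t f) x y = eval2 f (x + t * y) y"
  unfolding shear_def eval2_eq_sum[of f]
  by (simp add: eval2_altdef poly_sum poly_monom case_prod_unfold mult.commute)
    (simp add: algebra_simps)

lemma coeff_linear_power:
  fixes u v :: "'a :: comm_ring_1"
  shows "coeff ([:u, v:] ^ a) a = v ^ a" and "k > a \<Longrightarrow> coeff ([:u, v:] ^ a) k = 0"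
proof -
  have "coeff ([:u, v:] ^ a) a = v ^ a \<and> (\<forall>k>a. coeff ([:u, v:] ^ a) k = 0)"
    by (induction a) (auto simp: coeff_pCons split: nat.splits)
  then show "coeff ([:u, v:] ^ a) a = v ^ a" and "k > a \<Longrightarrow> coeff ([:u, v:] ^ a) k = 0"
    by auto
qed

text \<open>With d the total degree of f, \<open>top\<close> is the degree-d form of f at (t, 1).
  This is the coefficient of Y^d in f(X + tY, Y), so its finitely many roots are the only bad
  shears.\<close>

lemma shear_lead_coeff:
  assumes "f \<noteq> 0"
  obtains top where "top \<noteq> 0"
    "\<And>t. poly top t \<noteq> 0 \<Longrightarrow> lead_coeff (shear t f) = [:poly top t:]"
    "\<And>t. poly top t \<noteq> 0 \<Longrightarrow> pos_degree f \<Longrightarrow> degree (shear t f) > 0"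
proof -
  define d where "d = Max ((\<lambda>(a, b). a + b) ` supp2 f)"
  define top where "top = (\<Sum>(a, b)\<in>supp2 f. if a + b = d then monom (cf2 f a b) a else 0)"
  have le: "a + b \<le> d" if "(a, b) \<in> supp2 f" for a b
    unfolding d_def using that by (intro Max_ge) (auto simp: finite_supp2 intro!: image_eqI[of _ _ "(a, b)"])
  have "d \<in> (\<lambda>(a, b). a + b) ` supp2 f"
    unfolding d_def using assms by (intro Max_in) (auto simp: finite_supp2 supp2_eq_empty_iff)
  then obtain a0 b0 where 0: "(a0, b0) \<in> supp2 f" "a0 + b0 = d" by auto
  \<comment> \<open>On the line a + b = d the exponent a determines b, so no cancellation occurs in
    \<open>top\<close>.\<close>
  have "coeff top a0 = (\<Sum>ab\<in>supp2 f. if ab = (a0, b0) then cf2 f a0 b0 else 0)"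
    unfolding top_def coeff_sum using 0(2) by (intro sum.cong) (auto split: if_splits)
  also have "\<dots> = cf2 f a0 b0" using 0(1) by (simp add: finite_supp2)
  finally have top0: "top \<noteq> 0" using 0(1) by (auto simp: supp2_def)
  define m where
    "m t a b = Polynomial.smult [:cf2 f a b:] ([:[:0, 1:], [:t:]:] ^ a * monom 1 b)" for t a b
  have shear: "shear t f = (\<Sum>(a, b)\<in>supp2 f. m t a b)" for t
    by (simp only: shear_def m_def)
  have monomial: "coeff (m t a b) k =
      (if k = d \<and> a + b = d then [:cf2 f a b * t ^ a:] else 0)"
    if "(a, b) \<in> supp2 f" "k \<ge> d" for a b k t
  proof -
    have "k \<ge> b" using le[OF that(1)] that(2) by linarith
    then have "coeff ([:[:0, 1:], [:t:]:] ^ a * monom 1 b) k = coeff ([:[:0, 1:], [:t:]:] ^ a) (k - b)"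
      by (subst mult.commute) (simp add: coeff_monom_mult)
    moreover have "k - b > a \<or> (k - b = a \<and> k = d \<and> a + b = d)"
      using le[OF that(1)] that(2) \<open>k \<ge> b\<close> by linarith
    moreover have "[:t:] ^ a = [:t ^ a:]" by (induction a) auto
    ultimately show ?thesis by (auto simp: m_def coeff_linear_power)
  qed
  have coeff_gt: "coeff (shear t f) k = 0" if "k > d" for t k
    unfolding shear coeff_sum using that by (intro sum.neutral) (auto simp: monomial)
  have "coeff (shear t f) d = (\<Sum>(a, b)\<in>supp2 f. [:poly (if a + b = d then monom (cf2 f a b) a else 0) t:])" for t
    unfolding shear coeff_sum by (intro sum.cong) (auto simp: monomial poly_monom)
  also have "\<dots> t = [:poly top t:]" for t
    unfolding top_def poly_sum by (induction rule: finite_induct[OF finite_supp2[of f]]) auto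
  finally have coeff_d: "coeff (shear t f) d = [:poly top t:]" for t .
  have deg: "degree (shear t f) = d" if "poly top t \<noteq> 0" for t
    using that coeff_gt[of _ t] coeff_d[of t]
    by (intro antisym degree_le le_degree) auto
  show ?thesis
  proof (rule that[OF top0])
    show "lead_coeff (shear t f) = [:poly top t:]" if "poly top t \<noteq> 0" for t
      using deg[OF that] coeff_d by simp
    show "degree (shear t f) > 0" if "poly top t \<noteq> 0" "pos_degree f" for t
      using deg[OF that(1)] that(2) le by (fastforce simp: pos_degree_def)
  qed
qed

text \<open>Over the complex numbers a gcd of positive degree has a root. The assumption excludes
  the gcd 0, which has degree 0 but vanishes everywhere.\<close>

lemma resultant_eq_0_iff_common_root:
  fixes p q :: "complex poly"
  assumes "p \<noteq> 0"
  shows "resultant p q = 0 \<longleftrightarrow> (\<exists>y. poly p y = 0 \<and> poly q y = 0)"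
proof
  assume "resultant p q = 0"
  then have "degree (gcd p q) \<noteq> 0" by (simp add: resultant_0_gcd)
  then obtain y where "poly (gcd p q) y = 0"
    using Fundamental_Theorem_Algebra.fundamental_theorem_of_algebra[of "gcd p q"] by (auto simp: constant_degree)
  then show "\<exists>y. poly p y = 0 \<and> poly q y = 0"
    by (meson dvd_trans gcd_dvd1 gcd_dvd2 poly_eq_0_iff_dvd)
next
  assume "\<exists>y. poly p y = 0 \<and> poly q y = 0"
  then obtain y where "[:- y, 1:] dvd gcd p q" by (auto simp: poly_eq_0_iff_dvd)
  moreover have "gcd p q \<noteq> 0" using assms by simp
  ultimately have "degree (gcd p q) \<noteq> 0"
    using dvd_imp_degree_le[of "[:- y, 1:]" "gcd p q"] by simp
  then show "resultant p q = 0" by (simp add: resultant_0_gcd)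
qed

lemma comm_ring_hom_eval2: "comm_ring_hom (\<lambda>f. eval2 f x y)"
  by unfold_locales (simp_all add: eval2_altdef)

text \<open>D is the resultant of g and h - T with respect to y. Constant leading coefficients keep
  both degrees under every specialisation of x and T, so the resultant commutes with
  evaluation.\<close>

lemma elimination_polynomial:
  assumes g: "lead_coeff g = [:c:]" "c \<noteq> 0" and h: "lead_coeff h = [:c':]" "c' \<noteq> 0" "degree h > 0"
  obtains D where "\<And>T x. eval2 D T x = 0 \<longleftrightarrow> (\<exists>y. eval2 g x y = 0 \<and> eval2 h x y = T)"
proof -
  \<comment> \<open>Here x becomes the outer variable and T the inner one, so the coefficients of
    \<open>D\<close> in x are polynomials in T. The triple constant in \<open>H\<close> below is
    T.\<close>
  define lift :: "complex poly \<Rightarrow> bipoly" where "lift = map_poly (\<lambda>c. [:c:])"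
  have eval_lift: "eval2 (lift p) T x = poly p x" for p T x
    by (induction p) (auto simp: lift_def eval2_altdef)
  have eval_T: "eval2 [:pCons 0 1:] T x = T" for T x
    by (simp add: eval2_altdef)
  have lift_0: "lift 0 = 0" by (simp add: lift_def)
  define G where "G = map_poly lift g"
  define H where "H = map_poly lift h - [:[:[:0, 1:]:]:]"
  define D where "D = resultant G H"
  have "eval2 D T x = 0 \<longleftrightarrow> (\<exists>y. eval2 g x y = 0 \<and> eval2 h x y = T)" for T x
  proof -
    interpret comm_ring_hom "\<lambda>f. eval2 f T x" by (rule comm_ring_hom_eval2)
    define g' h' where "g' = map_poly (\<lambda>p. poly p x) g" and "h' = map_poly (\<lambda>p. poly p x) h - [:T:]"
    have g'_eq: "map_poly (\<lambda>f. eval2 f T x) G = g'"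
      by (rule poly_eqI) (simp add: G_def g'_def coeff_map_poly eval_lift lift_0)
    have h'_eq: "map_poly (\<lambda>f. eval2 f T x) H = h'"
      by (rule poly_eqI)
        (auto simp: H_def h'_def coeff_map_poly eval_lift lift_0 hom_minus coeff_pCons
          eval_T split: nat.splits)
    have lead_g': "coeff g' (degree g) \<noteq> 0"
      using g by (simp add: g'_def coeff_map_poly)
    have deg_g': "degree g' = degree g"
      using le_degree[OF lead_g'] degree_map_poly_le[of "\<lambda>p. poly p x" g]
      by (simp add: g'_def)
    have deg_G: "degree G = degree g"
    proof (rule antisym)
      show "degree G \<le> degree g" by (simp add: G_def degree_map_poly_le)
      show "degree g \<le> degree G" using deg_g' g'_eq degree_map_poly_le[of "\<lambda>f. eval2 f T x" G] by simp
    qed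
    \<comment> \<open>Positive degree of h matters here: subtracting T only changes the coefficient
      at 0.\<close>
    have lead_h': "coeff h' (degree h) \<noteq> 0"
      using h by (simp add: h'_def coeff_map_poly coeff_pCons split: nat.splits)
    have deg_H_le: "degree H \<le> degree h"
      unfolding H_def by (rule degree_diff_le) (simp_all add: degree_map_poly_le)
    have "degree h' \<le> degree H" using h'_eq degree_map_poly_le[of "\<lambda>f. eval2 f T x" H] by simp
    moreover have "degree h \<le> degree h'" using lead_h' by (rule le_degree)
    ultimately have "degree h' = degree H" using deg_H_le by simp
    then have "resultant g' h' = eval2 D T x"
      using resultant_map_poly(1)[of G H] deg_g' deg_G by (simp add: g'_eq h'_eq D_def)
    moreover have "g' \<noteq> 0" using lead_g' by auto
    ultimately show ?thesis
      using resultant_eq_0_iff_common_root[of g' h'] by (auto simp: g'_def h'_def eval2_def)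
  qed
  then show ?thesis by (rule that)
qed

text \<open>The eliminant, viewed as a polynomial in \<open>x\<close>, is constant for all small \<open>T\<close>, hence
  independent of \<open>x\<close>; its finitely many roots contain all values of \<open>h\<close>.\<close>

lemma bounded_below_imp_finite_values_monic:
  assumes g: "lead_coeff g = [:c:]" "c \<noteq> 0" and h: "lead_coeff h = [:c':]" "c' \<noteq> 0" "degree h > 0"
    and \<delta>: "\<delta> > 0" "\<And>x y. eval2 g x y = 0 \<Longrightarrow> cmod (eval2 h x y) \<ge> \<delta>"
  shows "finite {eval2 h x y |x y. eval2 g x y = 0}"
proof -
  obtain D where D: "\<And>T x. eval2 D T x = 0 \<longleftrightarrow> (\<exists>y. eval2 g x y = 0 \<and> eval2 h x y = T)"
    using elimination_polynomial[OF g h] by blast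
  \<comment> \<open>No point of the curve has a value of h below \<delta> in modulus, so for such T
    the eliminant has no root in x.\<close>
  have nz: "eval2 D T x \<noteq> 0" if "cmod T < \<delta>" for T x
    using D[of T x] \<delta>(2)[of x] that by force
  have "coeff D j = 0" if "j > 0" for j
  proof (rule ccontr)
    assume "coeff D j \<noteq> 0"
    then have "finite {T. poly (coeff D j) T = 0}" by (rule poly_roots_finite)
    moreover have "ball 0 \<delta> \<subseteq> {T. poly (coeff D j) T = 0}"
    proof
      fix T :: complex
      assume "T \<in> ball 0 \<delta>"
      then have "poly (map_poly (\<lambda>p. poly p T) D) x \<noteq> 0" for x
        using nz[of T x] by (simp add: eval2_def)
      then have "degree (map_poly (\<lambda>p. poly p T) D) = 0"
        using Fundamental_Theorem_Algebra.fundamental_theorem_of_algebra[of "map_poly (\<lambda>p. poly p T) D"]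
        by (auto simp: constant_degree)
      then have "coeff (map_poly (\<lambda>p. poly p T) D) j = 0"
        using that by (intro coeff_eq_0) simp
      then show "T \<in> {T. poly (coeff D j) T = 0}" by (simp add: coeff_map_poly)
    qed
    ultimately have "finite (ball (0::complex) \<delta>)" by (rule rev_finite_subset)
    then show False using uncountable_ball[OF \<delta>(1), of "0::complex"] countable_finite by blast
  qed
  then have D_const: "D = [:coeff D 0:]"
    by (intro poly_eqI) (auto simp: coeff_pCons split: nat.splits)
  have ev: "eval2 D T x = poly (coeff D 0) T" for T x
    by (subst D_const) (simp add: eval2_altdef)
  have "coeff D 0 \<noteq> 0" using nz[of 0 0] \<delta>(1) ev by auto
  then have "finite {T. poly (coeff D 0) T = 0}" by (rule poly_roots_finite)
  then show ?thesis
    by (rule rev_finite_subset) (use D ev in auto)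
qed

text \<open>A shear is a bijection of the plane, so it preserves the bound and the set of values;
  one t outside the roots of both top forms serves g and h together.\<close>

lemma bounded_below_imp_finite_values:
  assumes "g \<noteq> 0" and "pos_degree h"
    and "\<delta> > 0" "\<And>x y. eval2 g x y = 0 \<Longrightarrow> cmod (eval2 h x y) \<ge> \<delta>"
  shows "finite {eval2 h x y |x y. eval2 g x y = 0}"
proof -
  have "h \<noteq> 0" using assms(2) by (auto simp: pos_degree_def supp2_def cf2_def)
  obtain tg where tg: "tg \<noteq> 0" "\<And>t. poly tg t \<noteq> 0 \<Longrightarrow> lead_coeff (shear t g) = [:poly tg t:]"
    using shear_lead_coeff[OF \<open>g \<noteq> 0\<close>] by metis
  obtain th where th: "th \<noteq> 0" "\<And>t. poly th t \<noteq> 0 \<Longrightarrow> lead_coeff (shear t h) = [:poly th t:]"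
    "\<And>t. poly th t \<noteq> 0 \<Longrightarrow> degree (shear t h) > 0"
    using shear_lead_coeff[OF \<open>h \<noteq> 0\<close>] assms(2) by metis
  obtain t where t: "poly (tg * th) t \<noteq> 0"
    using tg(1) th(1) by (metis mult_eq_0_iff poly_all_0_iff_0)
  have "{eval2 h x y |x y. eval2 g x y = 0} =
      {eval2 (shear t h) x y |x y. eval2 (shear t g) x y = 0}"
    unfolding eval2_shear
  proof (intro equalityI subsetI)
    fix T
    assume "T \<in> {eval2 h x y |x y. eval2 g x y = 0}"
    then obtain x y where "T = eval2 h x y" "eval2 g x y = 0" by blast
    then show "T \<in> {eval2 h (x + t * y) y |x y. eval2 g (x + t * y) y = 0}"
      by (intro CollectI exI[of _ "x - t * y"] exI[of _ y]) simp
  qed blast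
  then show ?thesis
    using t by (simp, intro bounded_below_imp_finite_values_monic[OF tg(2) _ th(2) _ th(3) assms(3)])
      (auto simp: eval2_shear assms(4))
qed

subsection \<open>Escaping sequences on a curve\<close>

text \<open>Stated through values on the axis, the condition passes from a product to its
  factors.\<close>

lemma cf2_x_axis_iff: "(\<exists>a. cf2 f a 0 \<noteq> 0) \<longleftrightarrow> (\<exists>x. eval2 f x 0 \<noteq> 0)"
proof -
  have "(\<exists>a. cf2 f a 0 \<noteq> 0) \<longleftrightarrow> coeff f 0 \<noteq> 0" by (auto simp: cf2_def poly_eq_iff)
  also have "\<dots> \<longleftrightarrow> (\<exists>x. poly (coeff f 0) x \<noteq> 0)" by (metis poly_all_0_iff_0)
  also have "\<dots> \<longleftrightarrow> (\<exists>x. eval2 f x 0 \<noteq> 0)" by (simp add: eval2_altdef poly_0_coeff_0)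
  finally show ?thesis .
qed

lemma cf2_y_axis_iff: "(\<exists>b. cf2 f 0 b \<noteq> 0) \<longleftrightarrow> (\<exists>y. eval2 f 0 y \<noteq> 0)"
proof -
  have "(\<exists>b. cf2 f 0 b \<noteq> 0) \<longleftrightarrow> map_poly (\<lambda>p. poly p 0) f \<noteq> 0"
    by (auto simp: cf2_def poly_eq_iff coeff_map_poly poly_0_coeff_0)
  also have "\<dots> \<longleftrightarrow> (\<exists>y. eval2 f 0 y \<noteq> 0)" unfolding eval2_def by (metis poly_all_0_iff_0)
  finally show ?thesis .
qed

lemma finite_axis_zeros:
  assumes "\<exists>a. cf2 f a 0 \<noteq> 0" "\<exists>b. cf2 f 0 b \<noteq> 0"
  shows "finite {(x, y). eval2 f x y = 0 \<and> (x = 0 \<or> y = 0)}"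
proof -
  obtain x0 where "eval2 f x0 0 \<noteq> 0" using assms(1) cf2_x_axis_iff by blast
  then have "poly f 0 \<noteq> 0" by (auto simp: eval2_altdef)
  then have "finite {x. eval2 f x 0 = 0}"
    using poly_roots_finite[of "poly f 0"] by (simp add: eval2_altdef)
  moreover obtain y0 where "eval2 f 0 y0 \<noteq> 0" using assms(2) cf2_y_axis_iff by blast
  then have "map_poly (\<lambda>p. poly p 0) f \<noteq> 0" by (auto simp: eval2_def)
  then have "finite {y. eval2 f 0 y = 0}"
    using poly_roots_finite[of "map_poly (\<lambda>p. poly p 0) f"] by (simp add: eval2_def)
  ultimately have "finite ((\<lambda>x. (x, 0)) ` {x. eval2 f x 0 = 0} \<union> Pair 0 ` {y. eval2 f 0 y = 0})"
    by simp
  then show ?thesis by (rule rev_finite_subset) auto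
qed

text \<open>The largest term must be cancelled by the at most \<open>card S - 1\<close> others, so
  one of these has at least 1 / \<open>card S\<close> of its modulus.\<close>

lemma two_comparable_terms:
  fixes t :: "'a \<Rightarrow> complex"
  assumes "finite S" "S \<noteq> {}" "sum t S = 0" and nz: "\<And>i. i \<in> S \<Longrightarrow> t i \<noteq> 0"
  obtains i j where "i \<in> S" "j \<in> S" "i \<noteq> j" "\<bar>ln (cmod (t i)) - ln (cmod (t j))\<bar> \<le> ln (card S)"
proof -
  define M where "M = Max ((\<lambda>i. cmod (t i)) ` S)"
  have "M \<in> (\<lambda>i. cmod (t i)) ` S" unfolding M_def using assms by (intro Max_in) auto
  then obtain i where i: "i \<in> S" "cmod (t i) = M" by auto
  have le: "cmod (t j) \<le> cmod (t i)" if "j \<in> S" for j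
    unfolding i(2) M_def using that assms by (intro Max_ge) auto
  have N: "card S > 0" using assms by (simp add: card_gt_0_iff)
  have "\<exists>j\<in>S - {i}. cmod (t i) \<le> card S * cmod (t j)"
  proof (rule ccontr)
    assume "\<not> ?thesis"
    then have lt: "cmod (t j) \<le> cmod (t i) / card S" if "j \<in> S - {i}" for j
      using that N by (auto simp: field_simps not_le intro: less_imp_le)
    have "t i = - sum t (S - {i})"
      using assms(1,3) i(1) by (simp add: sum.remove eq_neg_iff_add_eq_0)
    then have "cmod (t i) \<le> (\<Sum>j\<in>S - {i}. cmod (t j))" by (simp add: norm_sum)
    also have "\<dots> \<le> card (S - {i}) * (cmod (t i) / card S)" using lt by (rule sum_bounded_above)
    also have "\<dots> = (real (card S) - 1) / card S * cmod (t i)"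
      using i(1) N by (simp add: card_Diff_singleton of_nat_diff field_simps)
    also have "\<dots> < 1 * cmod (t i)"
      using N nz[OF i(1)] by (intro mult_strict_right_mono) (auto simp: field_simps)
    finally show False by simp
  qed
  then obtain j where j: "j \<in> S" "j \<noteq> i" "cmod (t i) \<le> card S * cmod (t j)" by auto
  have pos: "cmod (t i) > 0" "cmod (t j) > 0" using nz i(1) j(1) by auto
  have "ln (cmod (t i)) \<le> ln (card S * cmod (t j))" using j(3) pos N by (subst ln_le_cancel_iff) (auto simp: zero_less_mult_iff)
  also have "\<dots> = ln (card S) + ln (cmod (t j))" using N pos by (simp add: ln_mult)
  finally have "ln (cmod (t i)) - ln (cmod (t j)) \<le> ln (card S)" by simp
  moreover have "ln (cmod (t j)) \<le> ln (cmod (t i))" using le[OF j(1)] pos by simp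
  ultimately show ?thesis using that[OF i(1) j(1)] j(2) by auto
qed

text \<open>A substitute for Puiseux parametrisations at infinity: two monomials of \<open>g\<close> of comparable
  size along the sequence confine \<open>(ln \<bar>x\<bar>, ln \<bar>y\<bar>)\<close> to a strip around a line,
  whose direction is the weight vector.\<close>

lemma escaping_zeros_asymptotics:
  assumes axes: "\<exists>a. cf2 g a 0 \<noteq> 0" "\<exists>b. cf2 g 0 b \<noteq> 0"
    and zero: "\<And>n. eval2 g (X n) (Y n) = 0"
    and escape: "filterlim (\<lambda>n. cmod (X n) + cmod (Y n)) at_top sequentially"
  obtains r :: "nat \<Rightarrow> nat" and s :: "nat \<Rightarrow> real" and U V p q \<xi> \<eta> where
    "strict_mono r" "p > 0 \<or> q > 0" "filterlim s at_top sequentially" "U \<longlonglongrightarrow> \<xi>" "V \<longlonglongrightarrow> \<eta>" "\<xi> \<noteq> 0" "\<eta> \<noteq> 0"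
    "\<And>n. X (r n) = U n * of_real (exp (s n * p))" "\<And>n. Y (r n) = V n * of_real (exp (s n * q))"
proof -
  define S where "S = supp2 g"
  have S: "finite S" "S \<noteq> {}"
    using axes(1) finite_supp2[of g] by (auto simp: S_def supp2_def)
  define L where "L n = (ln (cmod (X n)), ln (cmod (Y n)))" for n
  define C where "C ab = cmod (cf2 g (fst ab) (snd ab))" for ab
  define K where "K = ln (card S) + 2 * (\<Sum>ab\<in>S. \<bar>ln (C ab)\<bar>)"
  define u where "u ab cd = (real (fst ab) - real (fst cd), real (snd ab) - real (snd cd))"
    for ab cd :: "nat \<times> nat"
  \<comment> \<open>The bound says that two monomials are comparable at the n-th point;
    \<open>K\<close> absorbs the coefficients. The last conjunct orients the exponent difference:
    swapping the pair flips its sign, so it can always be met, and it makes \<open>s\<close>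
    nonnegative.\<close>
  define R where "R n P \<longleftrightarrow> fst P \<in> S \<and> snd P \<in> S \<and> fst P \<noteq> snd P \<and>
      \<bar>fst (u (fst P) (snd P)) * fst (L n) + snd (u (fst P) (snd P)) * snd (L n)\<bar> \<le> K \<and>
      fst (u (fst P) (snd P)) * snd (L n) - snd (u (fst P) (snd P)) * fst (L n) \<ge> 0" for n P
  \<comment> \<open>The curve meets the axes in finitely many points, so an escaping sequence
    eventually stays in the torus and the logarithms are meaningful.\<close>
  have "\<forall>\<^sub>F n in sequentially. X n \<noteq> 0 \<and> Y n \<noteq> 0"
  proof -
    let ?Z = "{(x, y). eval2 g x y = 0 \<and> (x = 0 \<or> y = 0)}"
    let ?N = "\<lambda>(x, y). cmod x + cmod y"
    have fin: "finite (?N ` ?Z)" using finite_axis_zeros[OF axes] by simp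
    have "\<forall>\<^sub>F n in sequentially. cmod (X n) + cmod (Y n) > Max (insert 0 (?N ` ?Z))"
      using escape by (simp add: filterlim_at_top_dense)
    then show ?thesis
    proof eventually_elim
      case (elim n)
      have "(X n, Y n) \<notin> ?Z"
      proof
        assume "(X n, Y n) \<in> ?Z"
        then have "?N (X n, Y n) \<in> insert 0 (?N ` ?Z)" by (intro insertI2 imageI)
        with fin have "?N (X n, Y n) \<le> Max (insert 0 (?N ` ?Z))" by (intro Max_ge finite.insertI)
        then show False using elim by simp
      qed
      then show ?case using zero[of n] by auto
    qed
  qed
  then obtain M where M: "\<And>n. n \<ge> M \<Longrightarrow> X n \<noteq> 0 \<and> Y n \<noteq> 0"
    by (auto simp: eventually_sequentially)
  have "\<exists>P\<in>S \<times> S. R n P" if "n \<in> {M..}" for n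
  proof -
    have XY: "X n \<noteq> 0" "Y n \<noteq> 0" using M that by auto
    define t where "t ab = cf2 g (fst ab) (snd ab) * X n ^ fst ab * Y n ^ snd ab" for ab
    have t0: "sum t S = 0" using zero[of n] by (simp add: eval2_eq_sum S_def t_def)
    have C0: "C ab > 0" if "ab \<in> S" for ab
      using that by (auto simp: C_def S_def supp2_def)
    have nz: "t ab \<noteq> 0" if "ab \<in> S" for ab
      using C0[OF that] XY by (auto simp: t_def C_def)
    obtain i j where ij: "i \<in> S" "j \<in> S" "i \<noteq> j"
      "\<bar>ln (cmod (t i)) - ln (cmod (t j))\<bar> \<le> ln (card S)"
      using two_comparable_terms[OF S t0 nz] by blast
    have ln_t: "ln (cmod (t ab)) = ln (C ab) + real (fst ab) * fst (L n) + real (snd ab) * snd (L n)"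
      if "ab \<in> S" for ab
      using C0[OF that] XY by (simp add: t_def C_def L_def norm_mult norm_power ln_mult ln_realpow)
    have lnC: "\<bar>ln (C ab)\<bar> \<le> (\<Sum>ab\<in>S. \<bar>ln (C ab)\<bar>)" if "ab \<in> S" for ab
      using that S(1) by (intro member_le_sum) auto
    have "\<bar>fst (u i j) * fst (L n) + snd (u i j) * snd (L n)\<bar> \<le> K"
      using ij(4) lnC[OF ij(1)] lnC[OF ij(2)]
      unfolding ln_t[OF ij(1)] ln_t[OF ij(2)] by (simp add: u_def K_def algebra_simps)
    moreover have "fst (u j i) = - fst (u i j)" "snd (u j i) = - snd (u i j)" by (auto simp: u_def)
    ultimately have "R n (i, j) \<or> R n (j, i)"
      using ij(1-3) unfolding R_def by auto
    then show ?thesis using ij by auto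
  qed
  \<comment> \<open>There are only finitely many pairs of exponents, so one pair serves infinitely
    many n.\<close>
  then obtain P where P: "infinite {n \<in> {M..}. R n P}"
    using pigeonhole_infinite_rel[of "{M..}" "S \<times> S" R] S(1) infinite_Ici by blast
  define I where "I = {n \<in> {M..}. R n P}"
  define r1 where "r1 = enumerate I"
  have r1: "strict_mono r1" "\<And>n. r1 n \<in> I"
    using P unfolding I_def[symmetric] r1_def
    by (auto simp: strict_mono_enumerate enumerate_in_set)
  define u1 u2 where "u1 = fst (u (fst P) (snd P))" and "u2 = snd (u (fst P) (snd P))"
  \<comment> \<open>The weight is the exponent difference turned by a right angle. Both vectors have
    squared length \<open>D\<close>, and \<open>s\<close>, \<open>\<rho>\<close> are the coordinates
    of \<open>L\<close> along them, with \<open>\<rho>\<close> bounded.\<close>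
  define p q where "p = - u2" and "q = u1"
  define D where "D = u1\<^sup>2 + u2\<^sup>2"
  have "fst P \<noteq> snd P" using r1(2)[of 0] by (auto simp: I_def R_def)
  then have "u1 \<noteq> 0 \<or> u2 \<noteq> 0" by (auto simp: u1_def u2_def u_def prod_eq_iff)
  then have D: "D > 0" by (auto simp: D_def sum_power2_gt_zero_iff)
  define s where "s n = (p * fst (L (r1 n)) + q * snd (L (r1 n))) / D" for n
  define \<rho> where "\<rho> n = (u1 * fst (L (r1 n)) + u2 * snd (L (r1 n))) / D" for n
  have s0: "s n \<ge> 0" for n
    using r1(2)[of n] D by (auto simp: I_def R_def s_def p_def q_def u1_def u2_def algebra_simps)
  have \<rho>: "\<bar>\<rho> n\<bar> \<le> K / D" for n
    using r1(2)[of n] D by (auto simp: I_def R_def \<rho>_def u1_def u2_def abs_divide divide_right_mono)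
  have L1: "fst (L (r1 n)) = s n * p + \<rho> n * u1" and L2: "snd (L (r1 n)) = s n * q + \<rho> n * u2" for n
    using D by (simp_all add: s_def \<rho>_def p_def q_def field_simps)
      (simp_all add: D_def power2_eq_square algebra_simps)
  have XY: "X (r1 n) \<noteq> 0" "Y (r1 n) \<noteq> 0" for n
    using M r1(2)[of n] by (auto simp: I_def)
  \<comment> \<open>With the growth along the weight removed, the moduli lie between 1 /
    \<open>E\<close> and \<open>E\<close>. Compactness then gives a subsequence with nonzero
    limits.\<close>
  define U0 V0 where "U0 n = X (r1 n) * of_real (exp (- s n * p))"
    and "V0 n = Y (r1 n) * of_real (exp (- s n * q))" for n
  define E where "E = exp (K / D * (\<bar>u1\<bar> + \<bar>u2\<bar>))"
  have norm_U0: "cmod (U0 n) = exp (\<rho> n * u1)" and norm_V0: "cmod (V0 n) = exp (\<rho> n * u2)" for n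
  proof -
    have "cmod (X (r1 n)) = exp (s n * p + \<rho> n * u1)" "cmod (Y (r1 n)) = exp (s n * q + \<rho> n * u2)"
      using L1[of n] L2[of n] XY[of n] by (simp_all add: L_def exp_ln flip: L1 L2)
    then show "cmod (U0 n) = exp (\<rho> n * u1)" "cmod (V0 n) = exp (\<rho> n * u2)"
      by (simp_all add: U0_def V0_def norm_mult norm_inverse exp_add exp_minus)
  qed
  have KD: "K / D \<ge> 0" using \<rho>[of 0] by linarith
  have bd: "\<bar>\<rho> n * u1\<bar> \<le> K / D * (\<bar>u1\<bar> + \<bar>u2\<bar>)" "\<bar>\<rho> n * u2\<bar> \<le> K / D * (\<bar>u1\<bar> + \<bar>u2\<bar>)" for n
    unfolding abs_mult by (rule mult_mono[OF \<rho> _ KD]; simp)+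
  have UV_le: "cmod (U0 n) \<le> E" "cmod (V0 n) \<le> E" for n
    using bd[of n] unfolding norm_U0 norm_V0 E_def by auto
  have UV_ge: "cmod (U0 n) \<ge> 1 / E" "cmod (V0 n) \<ge> 1 / E" for n
    using bd[of n] unfolding norm_U0 norm_V0 E_def by (auto simp: field_simps simp flip: exp_add)
  have X_eq: "X (r1 n) = U0 n * of_real (exp (s n * p))" and Y_eq: "Y (r1 n) = V0 n * of_real (exp (s n * q))" for n
    by (simp_all add: U0_def V0_def mult.assoc flip: of_real_mult exp_add)
  have escape1: "filterlim (\<lambda>n. cmod (X (r1 n)) + cmod (Y (r1 n))) at_top sequentially"
    using filterlim_compose[OF escape filterlim_subseq[OF r1(1)]] by simp
  have "compact (cball (0::complex) E \<times> cball (0::complex) E)"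
    by (intro compact_Times compact_cball)
  moreover have "(U0 n, V0 n) \<in> cball 0 E \<times> cball 0 E" for n using UV_le[of n] by simp
  ultimately obtain l r2 where r2: "strict_mono (r2 :: nat \<Rightarrow> nat)" "((\<lambda>n. (U0 n, V0 n)) \<circ> r2) \<longlonglongrightarrow> l"
    unfolding compact_def by (metis (no_types, lifting))
  have U: "(U0 \<circ> r2) \<longlonglongrightarrow> fst l" and V: "(V0 \<circ> r2) \<longlonglongrightarrow> snd l"
    using tendsto_fst[OF r2(2)] tendsto_snd[OF r2(2)] by (simp_all add: o_def)
  have E: "E > 0" by (simp add: E_def)
  have "cmod (fst l) \<ge> 1 / E"
    by (rule tendsto_lowerbound[OF tendsto_norm[OF U]]) (use UV_ge in auto)
  moreover have "cmod (snd l) \<ge> 1 / E"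
    by (rule tendsto_lowerbound[OF tendsto_norm[OF V]]) (use UV_ge in auto)
  ultimately have l0: "fst l \<noteq> 0" "snd l \<noteq> 0" using E by auto
  have size: "cmod (X (r1 n)) + cmod (Y (r1 n)) \<le> E * (exp (s n * p) + exp (s n * q))" for n
    unfolding X_eq Y_eq norm_mult using UV_le[of n]
    by (simp add: distrib_left add_mono mult_right_mono)
  \<comment> \<open>As \<open>s\<close> is nonnegative, two nonpositive weights would keep the
    points bounded.\<close>
  have pq: "p > 0 \<or> q > 0"
  proof (rule ccontr)
    assume "\<not> ?thesis"
    then have "s n * p \<le> 0" "s n * q \<le> 0" for n
      using s0[of n] by (auto simp: mult_le_0_iff)
    then have "exp (s n * p) + exp (s n * q) \<le> 2" for n
      using exp_le_cancel_iff[of "s n * p" 0] exp_le_cancel_iff[of "s n * q" 0] by (smt (verit) exp_zero)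
    then have "cmod (X (r1 n)) + cmod (Y (r1 n)) \<le> E * 2" for n
      using size[of n] E by (meson mult_left_mono order_less_imp_le order_trans)
    moreover have "\<forall>\<^sub>F n in sequentially. cmod (X (r1 n)) + cmod (Y (r1 n)) > E * 2"
      using escape1 by (simp add: filterlim_at_top_dense)
    ultimately show False by (meson eventually_happens' linorder_not_le sequentially_bot)
  qed
  have s_top: "filterlim s at_top sequentially"
    unfolding filterlim_at_top
  proof
    fix Z :: real
    let ?c = "\<bar>p\<bar> + \<bar>q\<bar>"
    have "\<forall>\<^sub>F n in sequentially. cmod (X (r1 n)) + cmod (Y (r1 n)) > E * (2 * exp (\<bar>Z\<bar> * ?c))"
      using escape1 by (simp add: filterlim_at_top_dense)
    then show "\<forall>\<^sub>F n in sequentially. Z \<le> s n"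
    proof eventually_elim
      case (elim n)
      show ?case
      proof (rule ccontr)
        assume "\<not> ?case"
        then have sZ: "s n \<le> \<bar>Z\<bar>" by simp
        have "s n * p \<le> \<bar>Z\<bar> * ?c" "s n * q \<le> \<bar>Z\<bar> * ?c"
          using sZ s0[of n] by (auto intro!: mult_mono' order_trans[OF mult_left_mono[of _ ?c]] mult_right_mono)
        then have "E * (exp (s n * p) + exp (s n * q)) \<le> E * (2 * exp (\<bar>Z\<bar> * ?c))"
          using E by (intro mult_left_mono) (smt (verit) exp_le_cancel_iff, simp)
        then show False using elim size[of n] by simp
      qed
    qed
  qed
  show ?thesis
  proof (rule that[of "r1 \<circ> r2" p q "s \<circ> r2" "U0 \<circ> r2" "fst l" "V0 \<circ> r2" "snd l"])
    show "strict_mono (r1 \<circ> r2)" using r1(1) r2(1) by (rule strict_mono_o)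
    show "filterlim (s \<circ> r2) at_top sequentially"
      unfolding o_def using s_top r2(1) by (rule filterlim_compose[OF _ filterlim_subseq])
  qed (use pq U V l0 X_eq Y_eq in auto)
qed

section \<open>A lower bound for one factor on the zero curve of the other\<close>

lemma continuous_on_eval2:
  assumes "continuous_on A X" "continuous_on A Y"
  shows "continuous_on A (\<lambda>z. eval2 f (X z) (Y z))"
  unfolding eval2_eq_sum by (intro continuous_intros assms)

lemma holomorphic_on_eval2:
  assumes "X holomorphic_on A" "Y holomorphic_on A"
  shows "(\<lambda>z. eval2 f (X z) (Y z)) holomorphic_on A"
  unfolding eval2_eq_sum by (intro holomorphic_intros assms)

text \<open>Compactness settles bounded parts of the curve. A sequence with h tending to 0 must
  therefore escape, and its asymptotics contradict the nonvanishing of the initial form of h at the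
  limit point.\<close>

lemma no_common_zero_imp_bounded_below:
  assumes g: "\<exists>a. cf2 g a 0 \<noteq> 0" "\<exists>b. cf2 g 0 b \<noteq> 0"
    and h: "\<exists>a. cf2 h a 0 \<noteq> 0" "\<exists>b. cf2 h 0 b \<noteq> 0"
    and no_zero: "\<And>x y. eval2 g x y = 0 \<Longrightarrow> eval2 h x y \<noteq> 0"
    and no_init: "\<And>p q x y. p > 0 \<or> q > 0 \<Longrightarrow> x \<noteq> 0 \<Longrightarrow> y \<noteq> 0 \<Longrightarrow>
      eval2 (initial g (p, q)) x y = 0 \<Longrightarrow> eval2 (initial h (p, q)) x y \<noteq> 0"
  obtains \<delta> where "\<delta> > 0" "\<And>x y. eval2 g x y = 0 \<Longrightarrow> cmod (eval2 h x y) \<ge> \<delta>"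
proof -
  have bounded_part: "\<exists>\<delta>>0. \<forall>x y. cmod x + cmod y \<le> B \<longrightarrow> eval2 g x y = 0 \<longrightarrow> cmod (eval2 h x y) \<ge> \<delta>" for B
  proof -
    let ?K = "{z :: complex \<times> complex. cmod (fst z) + cmod (snd z) \<le> B} \<inter> {z. eval2 g (fst z) (snd z) = 0}"
    have "closed ?K"
      by (intro closed_Int closed_Collect_le closed_Collect_eq continuous_on_eval2 continuous_intros)
    moreover have "?K \<subseteq> cball 0 B \<times> cball 0 B" by auto (smt (verit) norm_ge_zero)+
    then have "bounded ?K" by (rule bounded_subset[rotated]) (intro bounded_Times bounded_cball)
    ultimately have K: "compact ?K" by (simp add: compact_eq_bounded_closed)
    show ?thesis
    proof (cases "?K = {}")
      case True
      then show ?thesis by (intro exI[of _ 1]) (auto simp: set_eq_iff)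
    next
      case False
      have "continuous_on ?K (\<lambda>z. cmod (eval2 h (fst z) (snd z)))"
        by (intro continuous_on_norm continuous_on_eval2 continuous_intros)
      from continuous_attains_inf[OF K False this] obtain z where
        z: "z \<in> ?K" "\<And>y. y \<in> ?K \<Longrightarrow> cmod (eval2 h (fst z) (snd z)) \<le> cmod (eval2 h (fst y) (snd y))"
        by blast
      show ?thesis
        using z(1) z(2)[of "(_, _)"] no_zero
        by (intro exI[of _ "cmod (eval2 h (fst z) (snd z))"]) auto
    qed
  qed
  have "\<exists>\<delta>>0. \<forall>x y. eval2 g x y = 0 \<longrightarrow> cmod (eval2 h x y) \<ge> \<delta>"
  proof (rule ccontr)
    assume neg: "\<not> ?thesis"
    have "\<exists>x y. eval2 g x y = 0 \<and> cmod (eval2 h x y) < 1 / Suc n \<and> cmod x + cmod y > real n" for n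
    proof -
      obtain \<delta> where \<delta>: "\<delta> > 0"
        "\<And>x y. cmod x + cmod y \<le> n \<Longrightarrow> eval2 g x y = 0 \<Longrightarrow> cmod (eval2 h x y) \<ge> \<delta>"
        using bounded_part[of "real n"] by blast
      have "min \<delta> (1 / Suc n) > 0" using \<delta>(1) by simp
      then obtain x y where "eval2 g x y = 0" "cmod (eval2 h x y) < min \<delta> (1 / Suc n)"
        using neg by (meson linorder_not_le)
      with \<delta>(2)[of x y]
      have "eval2 g x y = 0 \<and> cmod (eval2 h x y) < 1 / Suc n \<and> cmod x + cmod y > real n"
        by (cases "cmod x + cmod y \<le> real n") auto
      then show ?thesis by blast
    qed
    then obtain X Y where XY: "\<And>n. eval2 g (X n) (Y n) = 0" "\<And>n. cmod (eval2 h (X n) (Y n)) < 1 / Suc n"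
      "\<And>n. cmod (X n) + cmod (Y n) > real n" by metis
    have "filterlim (\<lambda>n. cmod (X n) + cmod (Y n)) at_top sequentially"
      by (rule filterlim_at_top_mono[OF filterlim_real_sequentially])
        (use XY(3) in \<open>auto intro!: always_eventually less_imp_le\<close>)
    from escaping_zeros_asymptotics[OF g XY(1) this]
    obtain r :: "nat \<Rightarrow> nat" and s U V p q \<xi> \<eta> where r: "strict_mono r" and pq: "p > 0 \<or> q > 0"
      and s: "filterlim s at_top sequentially" and UV: "U \<longlonglongrightarrow> \<xi>" "V \<longlonglongrightarrow> \<eta>" "\<xi> \<noteq> 0" "\<eta> \<noteq> 0"
      and Xr: "\<And>n. X (r n) = U n * of_real (exp (s n * p))"
      and Yr: "\<And>n. Y (r n) = V n * of_real (exp (s n * q))" by metis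
    have "(\<lambda>n. of_real (exp (- s n * wdeg (p, q) g)) * eval2 g (X (r n)) (Y (r n)))
        \<longlonglongrightarrow> eval2 (initial g (p, q)) \<xi> \<eta>"
      unfolding Xr Yr using UV(1,2) s by (rule tendsto_scaled_eval2)
    then have "eval2 (initial g (p, q)) \<xi> \<eta> = 0"
      by (simp add: XY(1) LIMSEQ_const_iff)
    then have nz: "eval2 (initial h (p, q)) \<xi> \<eta> \<noteq> 0" using no_init[OF pq UV(3,4)] by blast
    have lim: "(\<lambda>n. of_real (exp (- s n * wdeg (p, q) h)) * eval2 h (X (r n)) (Y (r n)))
        \<longlonglongrightarrow> eval2 (initial h (p, q)) \<xi> \<eta>"
      unfolding Xr Yr using UV(1,2) s by (rule tendsto_scaled_eval2)
    \<comment> \<open>The support of h has a point on each axis; the one on the axis of a positive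
      weight gives the bound.\<close>
    have d: "wdeg (p, q) h \<ge> 0"
    proof -
      obtain a b where ab: "(a, 0) \<in> supp2 h" "(0, b) \<in> supp2 h"
        using h by (auto simp: supp2_def)
      have "wval (p, q) (a, 0) \<le> wdeg (p, q) h" "wval (p, q) (0, b) \<le> wdeg (p, q) h"
        using ab by (simp_all only: wval_le_wdeg)
      then show ?thesis
        using pq by (auto simp: wval_def intro: order_trans[rotated])
    qed
    have "\<forall>\<^sub>F n in sequentially. s n \<ge> 0" using s by (simp add: filterlim_at_top)
    then have "\<forall>\<^sub>F n in sequentially.
        cmod (of_real (exp (- s n * wdeg (p, q) h)) * eval2 h (X (r n)) (Y (r n))) \<le> 1 / Suc n"
    proof eventually_elim
      case (elim n)
      have "cmod (of_real (exp (- s n * wdeg (p, q) h)) * eval2 h (X (r n)) (Y (r n)))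
          \<le> 1 * cmod (eval2 h (X (r n)) (Y (r n)))"
        unfolding norm_mult using elim d by (intro mult_right_mono) auto
      also have "\<dots> \<le> 1 / Suc (r n)" using XY(2)[of "r n"] by simp
      also have "\<dots> \<le> 1 / Suc n"
        using seq_suble[OF r, of n] by (intro divide_left_mono) auto
      finally show ?case .
    qed
    then have "(\<lambda>n. of_real (exp (- s n * wdeg (p, q) h)) * eval2 h (X (r n)) (Y (r n))) \<longlonglongrightarrow> 0"
      by (rule Lim_null_comparison) (rule LIMSEQ_Suc[OF lim_1_over_n])
    with lim nz show False using LIMSEQ_unique by blast
  qed
  then show ?thesis using that by blast
qed

subsection \<open>Points of the curve near a torus zero of an initial form\<close>

lemma uniform_limit_finite_sum:
  fixes f :: "'i \<Rightarrow> 'n \<Rightarrow> 'a \<Rightarrow> 'b :: real_normed_vector"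
  assumes "finite I" "\<And>i. i \<in> I \<Longrightarrow> uniform_limit A (f i) (l i) F"
  shows "uniform_limit A (\<lambda>n z. \<Sum>i\<in>I. f i n z) (\<lambda>z. \<Sum>i\<in>I. l i z) F"
  using assms by (induction rule: finite_induct) (auto intro!: uniform_limit_intros)

text \<open>By Hurwitz's theorem, a zero (\<xi>, \<eta>) of the initial form of g is a limit of
  zeros of the rescaled g. At these h grows like \<open>exp (n * wdeg (p, q) h)\<close>, so a
  positive degree would make it unbounded.\<close>

lemma bounded_on_curve_imp_wdeg_nonpos:
  assumes "g \<noteq> 0" and B: "\<And>x y. eval2 g x y = 0 \<Longrightarrow> cmod (eval2 h x y) \<le> B"
    and g0: "eval2 (initial g (p, q)) \<xi> \<eta> = 0" and h0: "eval2 (initial h (p, q)) \<xi> \<eta> \<noteq> 0"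
  shows "wdeg (p, q) h \<le> 0"
proof (rule ccontr)
  assume "\<not> ?thesis"
  then have d: "wdeg (p, q) h > 0" by simp
  obtain x1 y1 where xy1: "eval2 (initial g (p, q)) x1 y1 \<noteq> 0"
    using nonzero_eval2E[OF initial_nonzero[OF \<open>g \<noteq> 0\<close>]] by blast
  \<comment> \<open>A complex line from (\<xi>, \<eta>) to a point where the initial form of g is
    nonzero reduces the problem to one variable.\<close>
  define x y where "x z = \<xi> + z * (x1 - \<xi>)" and "y z = \<eta> + z * (y1 - \<eta>)" for z
  define \<phi> where "\<phi> z = eval2 (initial g (p, q)) (x z) (y z)" for z
  define F where "F n z = of_real (exp (- real n * wdeg (p, q) g)) *
      eval2 g (x z * of_real (exp (real n * p))) (y z * of_real (exp (real n * q)))" for n z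
  \<comment> \<open>Zeros of \<open>F\<close> accumulating at z = 0 would be curve points where h is
    bounded, although h divided by its growth has a nonzero limit there.\<close>
  have "\<exists>k. \<forall>n\<ge>k. \<forall>z. cmod z < 1 / Suc k \<longrightarrow> F n z \<noteq> 0"
  proof (rule ccontr)
    assume "\<not> ?thesis"
    then have "\<forall>k. \<exists>n z. n \<ge> k \<and> cmod z < 1 / Suc k \<and> F n z = 0" by blast
    then obtain n z where nz: "\<And>k. n k \<ge> k" "\<And>k. cmod (z k) < 1 / Suc k" "\<And>k. F (n k) (z k) = 0"
      by metis
    have "z \<longlonglongrightarrow> 0"
      by (rule Lim_null_comparison[OF _ LIMSEQ_Suc[OF lim_1_over_n]])
        (use nz(2) in \<open>auto intro!: always_eventually less_imp_le\<close>)
    then have xy: "(\<lambda>k. x (z k)) \<longlonglongrightarrow> \<xi>" "(\<lambda>k. y (z k)) \<longlonglongrightarrow> \<eta>"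
      unfolding x_def y_def by (auto intro!: tendsto_eq_intros)
    have n_top: "filterlim (\<lambda>k. real (n k)) at_top sequentially"
      by (rule filterlim_at_top_mono[OF filterlim_real_sequentially]) (simp add: nz(1))
    define H where "H k = eval2 h (x (z k) * of_real (exp (real (n k) * p)))
        (y (z k) * of_real (exp (real (n k) * q)))" for k
    have "(\<lambda>k. of_real (exp (- real (n k) * wdeg (p, q) h)) * H k) \<longlonglongrightarrow> eval2 (initial h (p, q)) \<xi> \<eta>"
      unfolding H_def by (rule tendsto_scaled_eval2[OF xy n_top])
    moreover have "(\<lambda>k. of_real (exp (- real (n k) * wdeg (p, q) h)) * H k) \<longlonglongrightarrow> 0"
    proof (rule Lim_null_comparison)
      have "cmod (H k) \<le> B" for k
        unfolding H_def using nz(3)[of k] by (intro B) (simp add: F_def)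
      then show "\<forall>\<^sub>F k in sequentially. cmod (of_real (exp (- real (n k) * wdeg (p, q) h)) * H k)
          \<le> exp (real (n k) * (- wdeg (p, q) h)) * B"
        by (simp add: norm_mult)
      have "(\<lambda>k. cmod (of_real (exp (real (n k) * (- wdeg (p, q) h))))) \<longlonglongrightarrow> cmod 0"
        using tendsto_exp_face[OF _ n_top, of "- wdeg (p, q) h"] d by (intro tendsto_norm) auto
      then show "(\<lambda>k. exp (real (n k) * (- wdeg (p, q) h)) * B) \<longlonglongrightarrow> 0"
        by (intro tendsto_mult_left_zero) simp
    qed
    ultimately show False using h0 LIMSEQ_unique by blast
  qed
  then obtain k where k: "\<And>n z. n \<ge> k \<Longrightarrow> cmod z < 1 / Suc k \<Longrightarrow> F n z \<noteq> 0" by blast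
  let ?b = "ball 0 (1 / Suc k) :: complex set"
  have hol_xy: "x holomorphic_on A" "y holomorphic_on A" for A
    unfolding x_def y_def by (auto intro!: holomorphic_intros)
  have hol_\<phi>: "\<phi> holomorphic_on A" for A
    unfolding \<phi>_def by (intro holomorphic_on_eval2 hol_xy)
  \<comment> \<open>The shift by \<open>k\<close> makes every member of the sequence zero-free on
    the ball; Hurwitz carries this over to the limit.\<close>
  have "\<phi> 0 \<noteq> 0"
  proof (rule Hurwitz_no_zeros[of ?b "\<lambda>n. F (n + k)" \<phi> 0])
    show "F (n + k) holomorphic_on ?b" for n
      unfolding F_def by (intro holomorphic_intros holomorphic_on_eval2 hol_xy)
    show "\<phi> holomorphic_on ?b" by (rule hol_\<phi>)
    show "uniform_limit A (\<lambda>n. F (n + k)) \<phi> sequentially" if "compact A" "A \<subseteq> ?b" for A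
    proof -
      have eq: "\<phi> = (\<lambda>z. \<Sum>ab\<in>supp2 g. (if wval (p, q) ab - wdeg (p, q) g = 0 then 1 else 0) *
          (cf2 g (fst ab) (snd ab) * x z ^ fst ab * y z ^ snd ab))"
        unfolding \<phi>_def eval2_initial by (intro ext sum.cong) auto
      have top: "filterlim (\<lambda>n. real (n + k)) at_top sequentially"
        by (rule filterlim_compose[OF filterlim_real_sequentially filterlim_add_const_nat_at_top])
      have unif: "uniform_limit A (\<lambda>n z. of_real (exp (real (n + k) * (wval (p, q) ab - wdeg (p, q) g))) * T z)
          (\<lambda>z. (if wval (p, q) ab - wdeg (p, q) g = 0 then 1 else 0) * T z) sequentially"
        if "ab \<in> supp2 g" "continuous_on A T" for ab and T :: "complex \<Rightarrow> complex"
      proof (intro uniform_lim_mult uniform_limit_const)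
        show "uniform_limit A (\<lambda>n z. complex_of_real (exp (real (n + k) * (wval (p, q) ab - wdeg (p, q) g))))
            (\<lambda>z. if wval (p, q) ab - wdeg (p, q) g = 0 then 1 else 0) sequentially"
          using tendsto_exp_face[OF _ top, of "wval (p, q) ab - wdeg (p, q) g"] wval_le_wdeg[OF that(1)]
          by (simp add: uniform_limit_iff tendsto_iff)
        show "bounded (T ` A)"
          using compact_continuous_image[OF that(2) \<open>compact A\<close>] by (rule compact_imp_bounded)
        show "bounded ((\<lambda>z. if wval (p, q) ab - wdeg (p, q) g = 0 then 1 else 0 :: complex) ` A)"
          by (rule finite_imp_bounded) (rule finite_subset[of _ "{0, 1}"], auto)
      qed
      show ?thesis
        unfolding F_def scaled_eval2_eq_sum eq
        by (intro uniform_limit_finite_sum finite_supp2 unif)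
          (auto simp: x_def y_def intro!: continuous_intros)
    qed
    show "\<not> \<phi> constant_on ?b"
    proof
      assume "\<phi> constant_on ?b"
      then have "\<phi> z = \<phi> 0" if "z \<in> ?b" for z
        using that by (auto simp: constant_on_def)
      then have "\<phi> 1 = 0"
        using g0 hol_\<phi>
        by (intro analytic_continuation_open[of ?b UNIV \<phi> "\<lambda>_. 0" 1]) (auto simp: \<phi>_def x_def y_def)
      then show False using xy1 by (simp add: \<phi>_def x_def y_def)
    qed
    show "F (n + k) z \<noteq> 0" if "z \<in> ?b" for n z using k[of "n + k" z] that by simp
  qed auto
  then show False using g0 by (simp add: \<phi>_def x_def y_def)
qed

subsection \<open>Edges of the Newton polygon\<close>

text \<open>If the support is not a segment parallel to \<open>v\<close>, rotating the outer normal away from \<open>v\<close>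
  until a second support point is met produces an edge whose normal has positive scalar product
  with \<open>v\<close>.\<close>

lemma edge_or_parallel_segment:
  fixes v1 v2 :: real
  assumes "g \<noteq> 0" and v: "v1 \<noteq> 0 \<or> v2 \<noteq> 0"
  obtains (edge) p q \<alpha> \<beta> where "p * v1 + q * v2 > 0" "\<alpha> \<in> supp2 (initial g (p, q))"
      "\<beta> \<in> supp2 (initial g (p, q))" "\<alpha> \<noteq> \<beta>"
  | (segment) c where "\<And>\<alpha>. \<alpha> \<in> supp2 g \<Longrightarrow> wval (- v2, v1) \<alpha> = c"
proof -
  have v_pos: "v1 * v1 + v2 * v2 > 0"
    using v sum_power2_gt_zero_iff[of v1 v2] by (simp add: power2_eq_square)
  let ?v = "wval (v1, v2)"
  obtain \<alpha> where \<alpha>: "\<alpha> \<in> supp2 g" "?v \<alpha> = wdeg (v1, v2) g"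
    using wdeg_attained[OF \<open>g \<noteq> 0\<close>] by blast
  consider (tie) \<beta> where "\<beta> \<in> supp2 g" "\<beta> \<noteq> \<alpha>" "?v \<beta> = ?v \<alpha>"
    | (flat) "\<And>\<beta>. \<beta> \<in> supp2 g \<Longrightarrow> wval (- v2, v1) \<beta> = wval (- v2, v1) \<alpha>"
    | (rotate) \<beta> where "\<And>\<beta>. \<beta> \<in> supp2 g \<Longrightarrow> \<beta> \<noteq> \<alpha> \<Longrightarrow> ?v \<beta> < ?v \<alpha>" "\<beta> \<in> supp2 g"
      "wval (- v2, v1) \<beta> \<noteq> wval (- v2, v1) \<alpha>"
    using wval_le_wdeg[of _ g "(v1, v2)"] \<alpha> by (metis order_le_less)
  then show ?thesis
  proof cases
    case tie
    then show ?thesis using edge[of v1 v2 \<alpha> \<beta>] \<alpha> v_pos by (auto simp: supp2_initial)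
  next
    case flat
    then show ?thesis by (rule segment)
  next
    case rotate
    \<comment> \<open>The sign selects the sense of rotation that moves the normal towards
      \<open>\<beta>\<close>.\<close>
    define \<sigma> :: real where "\<sigma> = (if wval (- v2, v1) \<beta> > wval (- v2, v1) \<alpha> then 1 else - 1)"
    define u where "u = wval (- \<sigma> * v2, \<sigma> * v1)"
    have "u \<gamma> = \<sigma> * wval (- v2, v1) \<gamma>" for \<gamma> by (simp add: u_def wval_def algebra_simps)
    then have "u \<beta> > u \<alpha>" using rotate(3) by (auto simp: \<sigma>_def)
    define T where "T = {\<gamma> \<in> supp2 g. u \<gamma> > u \<alpha>}"
    \<comment> \<open>For the normal v + \<theta> \<sigma> (-v2, v1), this is the \<theta> at which
      the point draws level with \<open>\<alpha>\<close>. The smallest such value keeps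
      \<open>\<alpha>\<close> maximal and adds a second maximal point.\<close>
    define \<theta> where "\<theta> \<gamma> = (?v \<alpha> - ?v \<gamma>) / (u \<gamma> - u \<alpha>)" for \<gamma>
    have T: "finite T" "T \<noteq> {}"
      using \<open>u \<beta> > u \<alpha>\<close> rotate(2) finite_supp2[of g] unfolding T_def by (simp, blast)
    obtain \<beta>' where \<beta>': "\<beta>' \<in> T" "\<And>\<gamma>. \<gamma> \<in> T \<Longrightarrow> \<theta> \<beta>' \<le> \<theta> \<gamma>"
      using arg_min_if_finite(1)[OF T, of \<theta>] arg_min_least[OF T, of _ \<theta>] by blast
    have \<theta>_pos: "\<theta> \<beta>' \<ge> 0"
      using \<beta>'(1) wval_le_wdeg[of \<beta>' g "(v1, v2)"] \<alpha>(2) by (auto simp: \<theta>_def T_def)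
    define p q where "p = v1 - \<theta> \<beta>' * \<sigma> * v2" and "q = v2 + \<theta> \<beta>' * \<sigma> * v1"
    have w: "wval (p, q) \<gamma> = ?v \<gamma> + \<theta> \<beta>' * u \<gamma>" for \<gamma>
      by (simp add: wval_def p_def q_def u_def algebra_simps)
    have le: "wval (p, q) \<gamma> \<le> wval (p, q) \<alpha>" if "\<gamma> \<in> supp2 g" for \<gamma>
    proof (cases "\<gamma> \<in> T")
      case True
      then have "\<theta> \<beta>' * (u \<gamma> - u \<alpha>) \<le> ?v \<alpha> - ?v \<gamma>"
        using \<beta>'(2)[OF True] by (simp add: \<theta>_def T_def pos_le_divide_eq)
      then show ?thesis by (simp add: w algebra_simps)
    next
      case False
      then have "\<theta> \<beta>' * u \<gamma> \<le> \<theta> \<beta>' * u \<alpha>"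
        using that \<theta>_pos by (intro mult_left_mono) (auto simp: T_def)
      moreover have "?v \<gamma> \<le> ?v \<alpha>" using that \<alpha>(2) wval_le_wdeg by metis
      ultimately show ?thesis by (simp add: w)
    qed
    have "\<theta> \<beta>' * (u \<beta>' - u \<alpha>) = ?v \<alpha> - ?v \<beta>'" using \<beta>'(1) by (simp add: \<theta>_def T_def)
    then have eq: "wval (p, q) \<beta>' = wval (p, q) \<alpha>" by (simp add: w algebra_simps)
    have "wdeg (p, q) g = wval (p, q) \<alpha>"
      using wdeg_attained[OF \<open>g \<noteq> 0\<close>] le \<alpha>(1) wval_le_wdeg by (metis order_antisym)
    then have "\<alpha> \<in> supp2 (initial g (p, q))" "\<beta>' \<in> supp2 (initial g (p, q))"
      using \<alpha>(1) \<beta>'(1) eq by (auto simp: supp2_initial T_def)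
    \<comment> \<open>The added direction is perpendicular to v, so the scalar product stays equal
      to that of v with itself.\<close>
    moreover have "p * v1 + q * v2 > 0" using v_pos by (simp add: p_def q_def algebra_simps)
    moreover have "\<alpha> \<noteq> \<beta>'" using \<beta>'(1) by (auto simp: T_def)
    ultimately show ?thesis by (intro edge)
  qed
qed

subsection \<open>Near irreducibility\<close>

lemma pos_degree_imp_nonzero: "pos_degree f \<Longrightarrow> f \<noteq> 0"
  by (auto simp: pos_degree_def supp2_def cf2_def)

lemma pos_degree_imp_zero:
  assumes "pos_degree f"
  obtains x y where "eval2 f x y = 0"
proof -
  obtain a b where ab: "(a, b) \<in> supp2 f" "a + b > 0" using assms by (auto simp: pos_degree_def)
  show ?thesis
  proof (cases "supp2 f = {(a, b)}")
    case True
    then have "eval2 f 0 0 = 0" using ab(2) by (auto simp: eval2_eq_sum)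
    then show ?thesis by (rule that)
  next
    case False
    then obtain \<beta> where "\<beta> \<in> supp2 f" "(a, b) \<noteq> \<beta>" using ab(1) by blast
    then show ?thesis using torus_zero_exists[OF ab(1)] that by blast
  qed
qed

lemma not_pos_degree_imp_unit:
  assumes "f \<noteq> 0" "\<not> pos_degree f"
  shows "is_unit f"
proof -
  have "cf2 f a b = 0" if "a + b > 0" for a b
    using assms(2) that by (auto simp: pos_degree_def supp2_def)
  then have "f = [:[:cf2 f 0 0:]:]"
    by (intro cf2_eqI) (auto simp: cf2_def coeff_pCons split: nat.splits)
  moreover from this have "cf2 f 0 0 \<noteq> 0" using assms(1) by auto
  ultimately show ?thesis
    by (metis dvd_field_iff is_unit_const_poly_iff one_neq_zero)
qed

text \<open>A nonconstant gcd would have a zero, common to g and h; hence they are coprime in the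
  factorial ring C[X,Y].\<close>

lemma no_common_zero_imp_mult_dvd:
  assumes "g dvd f" "h dvd f" "g \<noteq> 0" "\<And>x y. eval2 g x y = 0 \<Longrightarrow> eval2 h x y \<noteq> 0"
  shows "g * h dvd f"
proof -
  have "\<not> pos_degree (gcd g h)"
  proof
    assume "pos_degree (gcd g h)"
    then obtain x y where "eval2 (gcd g h) x y = 0" by (rule pos_degree_imp_zero)
    then have "eval2 g x y = 0" "eval2 h x y = 0"
      by (metis dvdE eval2_mult gcd_dvd1 mult_zero_left, metis dvdE eval2_mult gcd_dvd2 mult_zero_left)
    then show False using assms(4) by blast
  qed
  then have "coprime g h"
    using assms(3) not_pos_degree_imp_unit[of "gcd g h"] by (simp add: is_unit_gcd_iff coprime_iff_gcd_eq_1)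
  then show ?thesis using assms(1,2) by (intro divides_mult)
qed

theorem theorem1p2:
  fixes f :: bipoly
  assumes "quasi_convenient f"
    and "nondeg_at_infinity f"
    and "\<forall>p q :: real. (p, q) \<noteq> (0, 0) \<and> p * q \<le> 0 \<longrightarrow>
           \<not> (\<exists>x y. x \<noteq> 0 \<and> y \<noteq> 0 \<and>
                 eval2 (initial f (p, q)) x y = 0 \<and>
                 eval2 (initial f (-p, -q)) x y = 0)"
  shows "nearly_irreducible f"
  unfolding nearly_irreducible_def
proof (intro conjI allI impI)
  show "pos_degree f" using assms(1) by (simp add: quasi_convenient_def)
  fix g h
  assume "g dvd f" "h dvd f" "pos_degree g" "pos_degree h"
  show "\<exists>x y. eval2 g x y = 0 \<and> eval2 h x y = 0"
  proof (rule ccontr)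
    assume "\<not> ?thesis"
    then have no_zero: "\<And>x y. eval2 g x y = 0 \<Longrightarrow> eval2 h x y \<noteq> 0" by blast
    have g0: "g \<noteq> 0" and h0: "h \<noteq> 0"
      using \<open>pos_degree g\<close> \<open>pos_degree h\<close> by (auto dest: pos_degree_imp_nonzero)
    then have "g * h dvd f"
      using \<open>g dvd f\<close> \<open>h dvd f\<close> no_zero by (intro no_common_zero_imp_mult_dvd)
    then obtain k where f: "f = g * h * k" by (elim dvdE)
    have k0: "k \<noteq> 0" using assms(1) f by (auto simp: quasi_convenient_def)
    have init: "initial f w = initial g w * initial h w * initial k w" for w
      using g0 h0 k0 by (simp add: f initial_mult)
    have axes: "(\<exists>x. eval2 f x 0 \<noteq> 0) \<and> (\<exists>y. eval2 f 0 y \<noteq> 0)"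
      using assms(1) unfolding quasi_convenient_def cf2_x_axis_iff cf2_y_axis_iff by blast
    have g_axes: "\<exists>a. cf2 g a 0 \<noteq> 0" "\<exists>b. cf2 g 0 b \<noteq> 0"
      and h_axes: "\<exists>a. cf2 h a 0 \<noteq> 0" "\<exists>b. cf2 h 0 b \<noteq> 0"
      using axes unfolding cf2_x_axis_iff cf2_y_axis_iff by (auto simp: f eval2_mult)
    have no_init: "eval2 (initial h (p, q)) x y \<noteq> 0"
      if "p > 0 \<or> q > 0" "x \<noteq> 0" "y \<noteq> 0" "eval2 (initial g (p, q)) x y = 0" for p q x y
    proof
      assume "eval2 (initial h (p, q)) x y = 0"
      with that(4) have "eval2 (initial f (p, q)) x y = 0"
        "eval2 (pderivX (initial f (p, q))) x y = 0" "eval2 (pderivY (initial f (p, q))) x y = 0"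
        by (simp_all add: init pderivX_mult pderivY_mult eval2_mult eval2_add)
      then show False using assms(2) that(1-3) unfolding nondeg_at_infinity_def by blast
    qed
    obtain \<delta> where \<delta>: "\<delta> > 0" "\<And>x y. eval2 g x y = 0 \<Longrightarrow> cmod (eval2 h x y) \<ge> \<delta>"
      using no_common_zero_imp_bounded_below[OF g_axes h_axes no_zero no_init] by blast
    have "bounded {eval2 h x y |x y. eval2 g x y = 0}"
      using bounded_below_imp_finite_values[OF g0 \<open>pos_degree h\<close> \<delta>] by (rule finite_imp_bounded)
    then obtain B where "\<forall>T\<in>{eval2 h x y |x y. eval2 g x y = 0}. cmod T \<le> B"
      unfolding bounded_iff by blast
    then have B: "cmod (eval2 h x y) \<le> B" if "eval2 g x y = 0" for x y using that by blast
    \<comment> \<open>Any nonconstant monomial of h will do: a normal with positive product against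
      its exponent has a positive entry and gives h positive weighted degree.\<close>
    obtain v1 v2 where v: "(v1, v2) \<in> supp2 h" "v1 + v2 > 0"
      using \<open>pos_degree h\<close> by (auto simp: pos_degree_def)
    have "real v1 \<noteq> 0 \<or> real v2 \<noteq> 0" using v(2) by auto
    from g0 this show False
    proof (cases rule: edge_or_parallel_segment)
      case (edge p q \<alpha> \<beta>)
      obtain x y where xy: "x \<noteq> 0" "y \<noteq> 0" "eval2 (initial g (p, q)) x y = 0"
        using torus_zero_exists[OF edge(2-4)] by blast
      have "p > 0 \<or> q > 0"
      proof (rule ccontr)
        assume "\<not> ?thesis"
        then have "p * real v1 + q * real v2 \<le> 0"
          by (intro add_nonpos_nonpos mult_nonpos_nonneg) auto
        then show False using edge(1) by simp
      qed
      then have "wdeg (p, q) h \<le> 0"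
        using xy by (intro bounded_on_curve_imp_wdeg_nonpos[OF g0 B xy(3)] no_init)
      moreover have "wval (p, q) (v1, v2) \<le> wdeg (p, q) h" using v(1) by (rule wval_le_wdeg)
      ultimately show False using edge(1) by (simp add: wval_def)
    next
      case (segment c)
      let ?w = "(- real v2, real v1)" and ?w' = "(- (- real v2), - real v1)"
      have "wval ?w' \<alpha> = - c" if "\<alpha> \<in> supp2 g" for \<alpha>
        using segment[OF that] by (simp add: wval_def)
      then have init_g: "initial g ?w = g" "initial g ?w' = g"
        using segment by (auto intro: initial_eq_self)
      obtain a b where ab: "(a, 0) \<in> supp2 g" "(0, b) \<in> supp2 g"
        using g_axes by (auto simp: supp2_def)
      obtain i j where ij: "(i, j) \<in> supp2 g" "i + j > 0"
        using \<open>pos_degree g\<close> by (auto simp: pos_degree_def)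
      \<comment> \<open>An exponent other than the origin cannot lie on both axes, so g has two
        distinct monomials and hence a zero in the torus.\<close>
      have "(i, j) \<noteq> (a, 0) \<or> (i, j) \<noteq> (0, b)" using ij(2) by auto
      then obtain x y where xy: "x \<noteq> 0" "y \<noteq> 0" "eval2 g x y = 0"
        using torus_zero_exists[OF ij(1) ab(1)] torus_zero_exists[OF ij(1) ab(2)] by metis
      have "eval2 (initial f ?w) x y = 0" "eval2 (initial f ?w') x y = 0"
        using xy(3) by (simp_all only: init init_g eval2_mult mult_zero_left)
      moreover have "?w \<noteq> (0, 0)" "- real v2 * real v1 \<le> 0" using v(2) by auto
      ultimately show False using assms(3) xy(1,2) by blast
    qed
  qed
qed

end
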